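(* Let $p$ be a prime number, let $e>1$ be a positive integer, let $n\geq 3$ be an integer satisfying $3\cdot 2^{n-2}<e$, and let $i_j=2^{j-1}$ for $1\leq j\leq n$. Let $\theta$ be a primitive element of the finite field $\mathbb{F}_{p^e}$, i.e., a generator of its multiplicative group. Then $$\mathcal{C}=\left\{\left(\lambda+\mu\theta^{i_1},\ \lambda+\mu\theta^{i_2},\ \ldots,\ \lambda+\mu\theta^{i_n}\right) : \lambda,\mu\in\mathbb{F}_{p^e}\right\}$$ is a two-dimensional Reed-Solomon code of length $n$ over $\mathbb{F}_{p^e}$ whose minimum insdel distance is $d(\mathcal{C})=2n-4$.
   Context: For a finite field $\mathbb{F}_q$ and $\mathbf{a},\mathbf{b}\in\mathbb{F}_q^n$, the insdel distance $d(\mathbf{a},\mathbf{b})$ is the minimum number of insertions and deletions (of single symbols of $\mathbb{F}_q$) needed to transform $\mathbf{a}$ into $\mathbf{b}$. (It is a known fact that $d(\mathbf{a},\mathbf{b})=2n-2\ell$, where $\ell$ is the length of a longest common subsequence of $\mathbf{a}$ and $\mathbf{b}$.) The minimum insdel distance of a linear code $\mathcal{C}\subseteq\mathbb{F}_q^n$ is $d(\mathcal{C})=\min\{d(\mathbf{c}_1,\mathbf{c}_2) : \mathbf{c}_1,\mathbf{c}_2\in\mathcal{C},\ \mathbf{c}_1\neq\mathbf{c}_2\}$. For $1\leq k<n$ and $n$ distinct elements $\alpha_1,\ldots,\alpha_n\in\mathbb{F}_q$, the Reed-Solomon code of length $n$ and dimension $k$ with code locators $\alpha_1,\ldots,\alpha_n$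 is $\{(f(\alpha_1),\ldots,f(\alpha_n)) : f\in\mathbb{F}_q[x],\ \deg f<k\}$. *)

theory Defs
  imports
    "Jordan_Normal_Form.VS_Connect"
    "HOL-Computational_Algebra.Primes"
    "HOL-Computational_Algebra.Polynomial"
begin

inductive insdel_step :: "'a list \<Rightarrow> 'a list \<Rightarrow> bool" where
  ins: "insdel_step (us @ vs) (us @ a # vs)"
| del: "insdel_step (us @ a # vs) (us @ vs)"

text \<open>The intermediate words of a chain of steps may have any length.\<close>

definition insdel_dist :: "'a list \<Rightarrow> 'a list \<Rightarrow> nat" where
  "insdel_dist xs ys = (LEAST k. (insdel_step ^^ k) xs ys)"

text \<open>An infimum of natural numbers is attained as soon as the set is nonempty, that is, as
  soon as the code has two distinct words.\<close>

definition min_insdel_dist :: "'a vec set \<Rightarrow> nat" where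
  "min_insdel_dist C =
    Inf {insdel_dist (list_of_vec c) (list_of_vec d) | c d. c \<in> C \<and> d \<in> C \<and> c \<noteq> d}"

definition linear_code :: "nat \<Rightarrow> nat \<Rightarrow> 'a :: field vec set \<Rightarrow> bool" where
  "linear_code n k C \<longleftrightarrow>
    VectorSpace.subspace class_ring C (module_vec TYPE('a) n) \<and>
    vectorspace.dim class_ring (module_vec TYPE('a) n\<lparr>carrier := C\<rparr>) = k"

text \<open>Since \<open>k > 0\<close> below and the zero polynomial has degree \<open>0\<close>, the condition
  \<open>degree f < k\<close> includes the zero polynomial.\<close>

definition reed_solomon_code :: "nat \<Rightarrow> nat \<Rightarrow> 'a :: field vec set \<Rightarrow> bool" where
  "reed_solomon_code n k C \<longleftrightarrow> 1 \<le> k \<and> k < n \<and>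
    (\<exists>\<alpha>. inj_on \<alpha> {..<n} \<and> C = {vec n (\<lambda>j. poly f (\<alpha> j)) | f. degree f < k})"

text \<open>As \<open>\<theta>\<close> itself is one of the powers, the equation forces \<open>\<theta> \<noteq> 0\<close>.\<close>

definition primitive_element :: "'a :: field \<Rightarrow> bool" where
  "primitive_element \<theta> \<longleftrightarrow> range (\<lambda>k :: int. \<theta> powi k) = UNIV - {0}"

end

theory Submission
  imports Defs "HOL-Library.Sublist" "HOL-Number_Theory.Residues"
begin

text \<open>
  A common subsequence of length three of two codewords yields two triples of locators
  \<open>x i = \<theta> ^ (2 ^ i)\<close> with equal ratios of differences. Multiplied out, and after the
  cancellation of the product of the two middle locators, this is an integer relation between six
  powers of \<open>\<theta>\<close> with exponents \<open>2 ^ a + 2 ^ b \<le> 3 * 2 ^ (n - 2) < e\<close>. Unless the triples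
  coincide, some exponent in it is strictly larger than all the others, so that a power
  \<open>\<theta> ^ d\<close> with \<open>d < e\<close> is an integer combination of lower powers. Then all powers of \<open>\<theta>\<close>,
  hence all \<open>p ^ e\<close> field elements, lie in a set with at most \<open>p ^ d\<close> elements.
\<close>

section \<open>Insdel distance and common subsequences\<close>

text \<open>Allows the surplus symbols over a given subsequence to be removed one at a time.\<close>

lemma subseq_delete_symbol:
  assumes "subseq zs xs" "length zs < length xs"
  obtains us a vs where "xs = us @ a # vs" "subseq zs (us @ vs)"
proof -
  have "\<exists>us a vs. xs = us @ a # vs \<and> subseq zs (us @ vs)"
    using assms
  proof (induction xs arbitrary: zs rule: list.induct)
    case (Cons x xs)
    show ?case
    proof (cases "subseq zs xs")
      case True
      then show ?thesis by (intro exI[of _ "[]"]) auto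
    next
      case False
      then obtain zs' where zs: "zs = x # zs'" "subseq zs' xs"
        using Cons.prems(1) by (cases zs) (auto split: if_splits)
      then obtain us a vs where "xs = us @ a # vs" "subseq zs' (us @ vs)"
        using Cons.IH[of zs'] Cons.prems(2) by auto
      then show ?thesis using zs
        by (intro exI[of _ "x # us"] exI[of _ a] exI[of _ vs]) auto
    qed
  qed simp
  then show ?thesis using that by blast
qed

lemma insdel_steps_to_subseq:
  assumes "subseq zs xs"
  shows "(insdel_step ^^ (length xs - length zs)) xs zs"
  using assms
proof (induction "length xs - length zs" arbitrary: xs)
  case 0
  then have "zs = xs"
    using subseq_same_length list_emb_length by (metis diff_is_0_eq le_antisym)
  then show ?case by simp
next
  case (Suc m)
  then have "length zs < length xs" by simp
  then obtain us a vs where xs: "xs = us @ a # vs" and sub: "subseq zs (us @ vs)"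
    using subseq_delete_symbol Suc.prems by blast
  have m: "m = length (us @ vs) - length zs" using Suc.hyps(2) xs by simp
  have "(insdel_step ^^ m) (us @ vs) zs" using Suc.hyps(1)[OF m sub] m by simp
  moreover have "insdel_step xs (us @ vs)" unfolding xs by (rule insdel_step.del)
  ultimately have "(insdel_step ^^ Suc m) xs zs" by (meson relpowp_Suc_I2)
  then show ?case using Suc.hyps(2) by simp
qed

lemma insdel_step_sym: "insdel_step xs ys \<Longrightarrow> insdel_step ys xs"
  by (cases rule: insdel_step.cases) (auto intro: insdel_step.intros)

lemma insdel_steps_sym: "(insdel_step ^^ k) xs ys \<Longrightarrow> (insdel_step ^^ k) ys xs"
proof (induction k arbitrary: ys)
  case (Suc k)
  then obtain ws where "(insdel_step ^^ k) xs ws" "insdel_step ws ys" by auto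
  then show ?case using Suc.IH insdel_step_sym relpowp_Suc_I2 by metis
qed simp

text \<open>Delete from \<open>xs\<close> down to \<open>zs\<close>, then run the deletions from
  \<open>ys\<close> down to \<open>zs\<close> backwards as insertions.\<close>

lemma insdel_steps_via_common_subseq:
  assumes "subseq zs xs" "subseq zs ys"
  shows "(insdel_step ^^ (length xs - length zs + (length ys - length zs))) xs ys"
  using insdel_steps_to_subseq[OF assms(1)] insdel_steps_sym[OF insdel_steps_to_subseq[OF assms(2)]]
  by (auto simp: relpowp_add)

text \<open>Split \<open>zs\<close> at the place of the deletion: only the head of the second part
  can have been matched with \<open>a\<close>, so dropping that head suffices.\<close>

lemma subseq_delete_one:
  assumes "subseq zs (us @ a # vs)"
  obtains zs' where "subseq zs' zs" "subseq zs' (us @ vs)" "length zs \<le> Suc (length zs')"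
proof -
  obtain ps qs where zs: "zs = ps @ qs" and p: "subseq ps us" and q: "subseq qs (a # vs)"
    using assms by (meson subseq_appendE)
  have "\<exists>rs. subseq rs qs \<and> subseq rs vs \<and> length qs \<le> Suc (length rs)"
  proof (cases "subseq qs vs")
    case False
    then show ?thesis using q by (cases qs) (auto split: if_splits)
  qed auto
  then obtain rs where "subseq rs qs" "subseq rs vs" "length qs \<le> Suc (length rs)" by blast
  then show ?thesis using that[of "ps @ rs"] zs p by (auto intro: list_emb_append_mono)
qed

text \<open>Each step is paid for by one unit of \<open>k\<close>. An insertion keeps
  \<open>zs\<close> and lengthens the word by one; a deletion shortens the word by one and costs at
  most one symbol of \<open>zs\<close>, which counts twice.\<close>

lemma common_subseq_of_insdel_steps:
  assumes "(insdel_step ^^ k) xs ys"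
  shows "\<exists>zs. subseq zs xs \<and> subseq zs ys \<and> length xs + length ys \<le> k + 2 * length zs"
  using assms
proof (induction k arbitrary: ys)
  case (Suc k)
  then obtain ws where "(insdel_step ^^ k) xs ws" and step: "insdel_step ws ys" by auto
  then obtain zs where zs: "subseq zs xs" "subseq zs ws"
      "length xs + length ws \<le> k + 2 * length zs"
    using Suc.IH by blast
  from step show ?case
  proof cases
    case (ins us vs a)
    have "subseq (us @ vs) (us @ a # vs)" by (intro list_emb_append_mono) auto
    then have "subseq zs ys" using zs(2) ins by (metis subseq_order.trans)
    then show ?thesis using zs ins by (intro exI[of _ zs]) auto
  next
    case (del us a vs)
    then obtain zs' where "subseq zs' zs" "subseq zs' ys" "length zs \<le> Suc (length zs')"
      using subseq_delete_one zs(2) by metis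
    then show ?thesis using zs del
      by (intro exI[of _ zs']) (auto intro: subseq_order.trans)
  qed
qed auto

lemma insdel_dist_le:
  assumes "subseq zs xs" "subseq zs ys"
  shows "insdel_dist xs ys \<le> length xs - length zs + (length ys - length zs)"
  unfolding insdel_dist_def by (rule Least_le) (rule insdel_steps_via_common_subseq[OF assms])

lemma common_subseq_of_insdel_dist:
  "\<exists>zs. subseq zs xs \<and> subseq zs ys \<and> length xs + length ys \<le> insdel_dist xs ys + 2 * length zs"
proof (rule common_subseq_of_insdel_steps)
  \<comment> \<open>The empty word is a common subsequence, so some chain exists and the least
    length is attained.\<close>
  show "(insdel_step ^^ insdel_dist xs ys) xs ys"
    unfolding insdel_dist_def
    by (rule LeastI) (rule insdel_steps_via_common_subseq[of "[]"]; simp)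
qed

text \<open>Turns a common subsequence into increasing positions, so that the locators at these
  positions can be compared.\<close>

lemma subseq_embedding:
  assumes "subseq zs xs"
  obtains f where "strict_mono_on {..<length zs} f"
    "\<And>i. i < length zs \<Longrightarrow> f i < length xs \<and> xs ! f i = zs ! i"
proof -
  have "\<exists>f. strict_mono_on {..<length zs} f \<and>
      (\<forall>i < length zs. f i < length xs \<and> xs ! f i = zs ! i)"
    using assms
  proof (induction rule: list_emb.induct)
    case (list_emb_Nil ys)
    then show ?case by (auto simp: strict_mono_on_def)
  next
    case (list_emb_Cons zs xs x)
    then obtain f where "strict_mono_on {..<length zs} f"
      "\<forall>i < length zs. f i < length xs \<and> xs ! f i = zs ! i" by blast
    then show ?case by (intro exI[of _ "\<lambda>i. Suc (f i)"]) (auto simp: strict_mono_on_def)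
  next
    case (list_emb_Cons2 z x zs xs)
    then obtain f where "strict_mono_on {..<length zs} f"
      "\<forall>i < length zs. f i < length xs \<and> xs ! f i = zs ! i" by blast
    then show ?case using list_emb_Cons2.hyps
      by (intro exI[of _ "\<lambda>i. case i of 0 \<Rightarrow> 0 | Suc i \<Rightarrow> Suc (f i)"])
        (auto simp: strict_mono_on_def split: nat.splits)
  qed
  then show ?thesis using that by blast
qed

section \<open>Reed-Solomon codes are linear\<close>

text \<open>By rank-nullity: the kernel of an injective map has dimension 0, so the image inherits
  the dimension \<open>k\<close> of the domain.\<close>

lemma linear_code_image:
  fixes T :: "'a :: field vec \<Rightarrow> 'a vec"
  assumes closed: "\<And>v. v \<in> carrier_vec k \<Longrightarrow> T v \<in> carrier_vec n"
    and add: "\<And>v w. v \<in> carrier_vec k \<Longrightarrow> w \<in> carrier_vec k \<Longrightarrow> T (v + w) = T v + T w"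
    and smult: "\<And>r v. v \<in> carrier_vec k \<Longrightarrow> T (r \<cdot>\<^sub>v v) = r \<cdot>\<^sub>v T v"
    and inj: "inj_on T (carrier_vec k)"
  shows "linear_code n k (T ` carrier_vec k)"
proof -
  interpret V: vec_space "TYPE('a)" k .
  interpret W: vec_space "TYPE('a)" n .
  have hom: "T \<in> LinearCombinations.module_hom class_ring (module_vec TYPE('a) k) (module_vec TYPE('a) n)"
    using closed add smult by (auto simp: LinearCombinations.module_hom_def module_vec_simps)
  interpret L: linear_map class_ring "module_vec TYPE('a) k" "module_vec TYPE('a) n" T
    unfolding linear_map_def mod_hom_def mod_hom_axioms_def
    using hom vec_vs vec_module by auto
  have im: "L.im = T ` carrier_vec k" by (simp add: L.im_def module_vec_simps)
  have "vectorspace.dim class_ring (module_vec TYPE('a) n\<lparr>carrier := L.im\<rparr>) = V.dim"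
    using L.rank_nullity[OF V.fin_dim] L.inj_imp_dim_ker0 inj by (simp add: module_vec_simps)
  then show ?thesis
    using L.imT_is_subspace unfolding linear_code_def im by (simp add: V.dim_is_n)
qed

text \<open>Evaluation is a linear map on coefficient vectors. It is injective because a polynomial
  of degree below \<open>k\<close> is determined by its values at \<open>n > k\<close> distinct
  points.\<close>

lemma reed_solomon_code_linear:
  assumes "reed_solomon_code n k C"
  shows "linear_code n k C"
proof -
  obtain \<alpha> where "1 \<le> k" "k < n" and inj: "inj_on \<alpha> {..<n}"
    and C: "C = {vec n (\<lambda>j. poly f (\<alpha> j)) | f. degree f < k}"
    using assms unfolding reed_solomon_code_def by blast
  define P where "P v = (\<Sum>i<k. Polynomial.monom (v $ i) i)" for v :: "'a vec"
  define T where "T v = vec n (\<lambda>j. poly (P v) (\<alpha> j))" for v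
  have coeff: "Polynomial.coeff (P v) i = (if i < k then v $ i else 0)" for v i
    by (auto simp: P_def coeff_sum)
  have deg: "degree (P v) < k" for v
    using \<open>1 \<le> k\<close> by (auto intro!: degree_lessI simp: coeff)
  have add: "P (v + w) = P v + P w" if "v \<in> carrier_vec k" "w \<in> carrier_vec k" for v w
    using that by (auto intro!: poly_eqI simp: coeff)
  have smult: "P (r \<cdot>\<^sub>v v) = Polynomial.smult r (P v)" if "v \<in> carrier_vec k" for r v
    using that by (auto intro!: poly_eqI simp: coeff)
  have "inj_on T (carrier_vec k)"
  proof (rule inj_onI)
    fix v w assume vw: "v \<in> carrier_vec k" "w \<in> carrier_vec k" "T v = T w"
    have "P v = P w"
    proof (rule poly_eqI_degree[of "\<alpha> ` {..<n}"])
      fix x assume "x \<in> \<alpha> ` {..<n}"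
      then obtain j where j: "j < n" "x = \<alpha> j" by blast
      have "T v $ j = T w $ j" using vw by simp
      then show "poly (P v) x = poly (P w) x" using j by (simp add: T_def)
    qed (use inj deg \<open>k < n\<close> less_trans in \<open>auto simp: card_image\<close>)
    then have "v $ i = w $ i" if "i < k" for i using coeff that by metis
    then show "v = w" using vw by (intro eq_vecI) auto
  qed
  then have "linear_code n k (T ` carrier_vec k)"
    by (intro linear_code_image) (auto simp: T_def add smult intro!: eq_vecI)
  moreover have "T ` carrier_vec k = C"
  proof -
    have "vec n (\<lambda>j. poly f (\<alpha> j)) = T (vec k (Polynomial.coeff f))" if "degree f < k" for f
    proof -
      have "P (vec k (Polynomial.coeff f)) = f"
        using that by (auto intro!: poly_eqI simp: coeff coeff_eq_0)
      then show ?thesis by (simp add: T_def)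
    qed
    then have "C \<subseteq> T ` carrier_vec k" unfolding C by (auto intro!: imageI)
    moreover have "T v \<in> C" for v unfolding C T_def using deg by blast
    ultimately show ?thesis by blast
  qed
  ultimately show ?thesis by simp
qed

section \<open>Integer relations between powers of a primitive element\<close>

text \<open>In a finite field this is the span of the first \<open>d\<close> powers over the prime
  field; integer coefficients avoid introducing that subfield.\<close>

definition int_span :: "'a :: comm_ring_1 \<Rightarrow> nat \<Rightarrow> 'a set" where
  "int_span \<theta> d = {\<Sum>k<d. of_int (c k) * \<theta> ^ k | c :: nat \<Rightarrow> int. True}"

lemma int_span_add: "x \<in> int_span \<theta> d \<Longrightarrow> y \<in> int_span \<theta> d \<Longrightarrow> x + y \<in> int_span \<theta> d"
proof -
  assume "x \<in> int_span \<theta> d" "y \<in> int_span \<theta> d"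
  then obtain a b where "x = (\<Sum>k<d. of_int (a k) * \<theta> ^ k)" "y = (\<Sum>k<d. of_int (b k) * \<theta> ^ k)"
    unfolding int_span_def by blast
  then have "x + y = (\<Sum>k<d. of_int (a k + b k) * \<theta> ^ k)"
    by (simp add: sum.distrib algebra_simps)
  then show ?thesis unfolding int_span_def by fast
qed

lemma int_span_scale: "x \<in> int_span \<theta> d \<Longrightarrow> of_int m * x \<in> int_span \<theta> d"
proof -
  assume "x \<in> int_span \<theta> d"
  then obtain a where "x = (\<Sum>k<d. of_int (a k) * \<theta> ^ k)"
    unfolding int_span_def by blast
  then have "of_int m * x = (\<Sum>k<d. of_int (m * a k) * \<theta> ^ k)"
    by (simp add: sum_distrib_left algebra_simps)
  then show ?thesis unfolding int_span_def by fast
qed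

lemma int_span_diff: "x \<in> int_span \<theta> d \<Longrightarrow> y \<in> int_span \<theta> d \<Longrightarrow> x - y \<in> int_span \<theta> d"
  using int_span_add[of x \<theta> d "- y"] int_span_scale[of y \<theta> d "-1"] by simp

lemma int_span_0: "0 \<in> int_span \<theta> d"
  unfolding int_span_def by (auto intro!: exI[of _ "\<lambda>_. 0"])

lemma int_span_power:
  assumes "k < d"
  shows "\<theta> ^ k \<in> int_span \<theta> d"
proof -
  have "(\<Sum>i<d. of_int (if i = k then 1 else 0) * \<theta> ^ i) = (\<Sum>i<d. if i = k then \<theta> ^ i else 0)"
    by (intro sum.cong) auto
  also have "\<dots> = \<theta> ^ k" using assms by simp
  finally show ?thesis unfolding int_span_def by (auto intro: sym)
qed

lemma int_span_sum:
  "(\<And>i. i \<in> A \<Longrightarrow> f i \<in> int_span \<theta> d) \<Longrightarrow> sum f A \<in> int_span \<theta> d"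
  by (induction A rule: infinite_finite_induct) (auto simp: int_span_0 int_span_add)

text \<open>Multiplication by \<open>\<theta>\<close> maps the span into itself, since only the new
  top power \<open>\<theta> ^ d\<close> has to be rewritten.\<close>

lemma int_span_all_powers:
  assumes "\<theta> ^ d \<in> int_span \<theta> d"
  shows "\<theta> ^ m \<in> int_span \<theta> d"
proof (induction m)
  case 0
  \<comment> \<open>For \<open>d = 0\<close> the span is zero and the claim is the assumption
    itself.\<close>
  then show ?case using assms by (cases "d = 0") (auto intro: int_span_power[of 0, simplified])
next
  case (Suc m)
  then obtain c where c: "\<theta> ^ m = (\<Sum>k<d. of_int (c k) * \<theta> ^ k)"
    unfolding int_span_def by blast
  have "\<theta> ^ Suc k \<in> int_span \<theta> d" if "k < d" for k
    using that assms int_span_power[of "Suc k" d \<theta>] by (cases "Suc k = d") auto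
  then have "(\<Sum>k<d. of_int (c k) * \<theta> ^ Suc k) \<in> int_span \<theta> d"
    by (intro int_span_sum int_span_scale) auto
  moreover have "\<theta> ^ Suc m = (\<Sum>k<d. of_int (c k) * \<theta> ^ Suc k)"
    by (simp add: c sum_distrib_left algebra_simps)
  ultimately show ?case by simp
qed

text \<open>Reducing the coefficients modulo the characteristic leaves the sum unchanged, so
  \<open>CHAR('a)\<close> choices for each coefficient suffice.\<close>

lemma card_int_span_le:
  fixes \<theta> :: "'a :: finite_field"
  shows "card (int_span \<theta> d) \<le> CHAR('a) ^ d"
proof -
  let ?p = "CHAR('a)"
  let ?F = "\<lambda>c :: nat \<Rightarrow> int. \<Sum>k<d. of_int (c k) * \<theta> ^ k"
  let ?A = "PiE {..<d} (\<lambda>_. {0..<int ?p})"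
  have p: "?p > 0" by simp
  have "int_span \<theta> d \<subseteq> ?F ` ?A"
  proof
    fix x assume "x \<in> int_span \<theta> d"
    then obtain c where x: "x = ?F c" unfolding int_span_def by blast
    have "of_int (c k mod int ?p) = (of_int (c k) :: 'a)" for k
    proof -
      have "(of_int (c k) :: 'a) = of_int (int ?p * (c k div int ?p) + c k mod int ?p)" by simp
      also have "\<dots> = of_int (c k mod int ?p)"
        unfolding of_int_add of_int_mult of_int_of_nat_eq by simp
      finally show ?thesis by simp
    qed
    then have "x = ?F (restrict (\<lambda>k. c k mod int ?p) {..<d})"
      unfolding x by (intro sum.cong) auto
    moreover have "restrict (\<lambda>k. c k mod int ?p) {..<d} \<in> ?A" using p by auto
    ultimately show "x \<in> ?F ` ?A" by blast
  qed
  then have "card (int_span \<theta> d) \<le> card (?F ` ?A)" by (intro card_mono) (auto intro!: finite_PiE)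
  also have "\<dots> \<le> card ?A" by (intro card_image_le finite_PiE) auto
  also have "\<dots> = ?p ^ d" by (simp add: card_PiE)
  finally show ?thesis .
qed

text \<open>Removes the negative exponents from the definition: \<open>\<theta>\<close> has finite
  order, and exponents can be reduced modulo a period.\<close>

lemma primitive_element_power:
  fixes \<theta> :: "'a :: finite_field"
  assumes "primitive_element \<theta>" "x \<noteq> 0"
  obtains m :: nat where "x = \<theta> ^ m"
proof -
  have rng: "range (\<lambda>k :: int. \<theta> powi k) = UNIV - {0}"
    using assms(1) unfolding primitive_element_def .
  then obtain k where k: "x = \<theta> powi k" using assms(2) by blast
  have nz: "\<theta> \<noteq> 0" using rng by (metis DiffD2 insertI1 power_int_1_right rangeI)
  have "\<not> inj (\<lambda>m :: nat. \<theta> ^ m)" by (metis finite_imageD finite_code infinite_UNIV_nat)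
  then obtain a b :: nat where "a < b" "\<theta> ^ a = \<theta> ^ b"
    unfolding inj_def by (metis linorder_neqE_nat)
  define r where "r = b - a"
  have r: "r > 0" "\<theta> ^ r = 1"
  proof -
    have "\<theta> ^ a * \<theta> ^ r = \<theta> ^ a * 1"
      unfolding power_add[symmetric] using \<open>a < b\<close> \<open>\<theta> ^ a = \<theta> ^ b\<close> by (simp add: r_def)
    then show "\<theta> ^ r = 1" using nz by simp
  qed (simp add: r_def \<open>a < b\<close>)
  have "x = \<theta> powi (k mod int r)"
  proof -
    have "x = \<theta> powi (int r * (k div int r) + k mod int r)" by (simp add: k)
    also have "\<dots> = \<theta> powi (int r * (k div int r)) * \<theta> powi (k mod int r)"
      using nz by (intro power_int_add) simp
    also have "\<dots> = (\<theta> ^ r) powi (k div int r) * \<theta> powi (k mod int r)"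
      by (simp only: power_int_mult power_int_of_nat)
    finally show ?thesis using r by simp
  qed
  also have "\<dots> = \<theta> ^ nat (k mod int r)" using r by (simp add: power_int_def)
  finally show ?thesis using that by blast
qed

text \<open>Otherwise the span would contain the whole field, too many elements for
  \<open>p ^ d\<close>. Thus \<open>\<theta>\<close> is a root of no monic polynomial of degree
  below \<open>e\<close> over the prime field.\<close>

lemma primitive_power_notin_int_span:
  fixes \<theta> :: "'a :: finite_field"
  assumes "primitive_element \<theta>" "card (UNIV :: 'a set) = CHAR('a) ^ e" "d < e"
  shows "\<theta> ^ d \<notin> int_span \<theta> d"
proof
  assume *: "\<theta> ^ d \<in> int_span \<theta> d"
  have "x \<in> int_span \<theta> d" for x
    using int_span_0 primitive_element_power[OF assms(1)] int_span_all_powers[OF *] by metis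
  then have "int_span \<theta> d = UNIV" by blast
  then have "CHAR('a) ^ e \<le> CHAR('a) ^ d" using card_int_span_le[of \<theta> d] assms(2) by simp
  moreover have "CHAR('a) > 1" using prime_CHAR_semidom[where ?'a = 'a] prime_gt_1_nat by simp
  ultimately show False using assms(3) by simp
qed

section \<open>Similar triples of locators\<close>

text \<open>Equality occurs for \<open>a = b = c - 1\<close>; in the uses below, a further positive
  summand on the right makes the inequality strict.\<close>

lemma two_powers_le: "a < c \<Longrightarrow> b < c \<Longrightarrow> (2 :: nat) ^ a + 2 ^ b \<le> 2 ^ c"
proof -
  assume "a < c" "b < c"
  then obtain d where c: "c = Suc d" "a \<le> d" "b \<le> d" by (cases c) auto
  then have "(2 :: nat) ^ a \<le> 2 ^ d" "(2 :: nat) ^ b \<le> 2 ^ d" by simp_all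
  then show ?thesis unfolding c power_Suc by linarith
qed

context
  fixes \<theta> :: "'a :: comm_ring_1" and e n :: nat
  assumes indep: "\<And>d. d < e \<Longrightarrow> \<theta> ^ d \<notin> int_span \<theta> d"
    and small: "3 * 2 ^ (n - 2) < e"
begin

text \<open>Solving for \<open>\<theta> ^ d\<close> would express it by five lower powers. Three
  terms on each side fit the expansion of \<open>similar_triples\<close>.\<close>

lemma no_dominant_power:
  assumes "d < e" "a < d" "b < d" "x < d" "y < d" "z < d"
  shows "\<theta> ^ d + \<theta> ^ a + \<theta> ^ b \<noteq> \<theta> ^ x + \<theta> ^ y + \<theta> ^ z"
proof
  assume "\<theta> ^ d + \<theta> ^ a + \<theta> ^ b = \<theta> ^ x + \<theta> ^ y + \<theta> ^ z"
  then have "\<theta> ^ d = \<theta> ^ x + \<theta> ^ y + \<theta> ^ z - \<theta> ^ a - \<theta> ^ b" by (simp add: algebra_simps)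
  also have "\<dots> \<in> int_span \<theta> d"
    using assms by (intro int_span_add int_span_diff int_span_power)
  finally show False using indep[OF assms(1)] by simp
qed

text \<open>The extreme case \<open>a = n - 2\<close>, \<open>b = n - 1\<close> gives exactly
  \<open>3 * 2 ^ (n - 2)\<close>, the quantity in the hypothesis.\<close>

lemma exponent_bound:
  assumes "a < b" "b < n"
  shows "2 ^ a + 2 ^ b < e"
proof -
  obtain m where n: "n = Suc (Suc m)" using assms by (cases n; cases "n - 1") auto
  have "(2 :: nat) ^ a \<le> 2 ^ m" "(2 :: nat) ^ b \<le> 2 ^ Suc m"
    using assms n by (intro power_increasing; simp)+
  then have "2 ^ a + 2 ^ b \<le> (3 :: nat) * 2 ^ m" unfolding power_Suc by linarith
  then show ?thesis using small n by simp
qed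

lemma inj_on_iterated_squares: "inj_on (\<lambda>j. \<theta> ^ (2 ^ j)) {..<n}"
proof (rule linorder_inj_onI)
  fix i j assume "i < j" "i \<in> {..<n}" "j \<in> {..<n}"
  then have "2 ^ j < e" using exponent_bound[of i j] by simp
  moreover have "\<theta> ^ (2 ^ i) \<in> int_span \<theta> (2 ^ j)" using \<open>i < j\<close> by (intro int_span_power) simp
  ultimately show "\<theta> ^ (2 ^ i) \<noteq> \<theta> ^ (2 ^ j)" using indep by metis
qed auto

text \<open>Equality of the ratios of consecutive differences, cross-multiplied because the context
  only provides a commutative ring.\<close>

abbreviation (input) similar_triples where
  "similar_triples i1 i2 i3 j1 j2 j3 \<equiv>
    (\<theta> ^ (2 ^ i1) - \<theta> ^ (2 ^ i2)) * (\<theta> ^ (2 ^ j2) - \<theta> ^ (2 ^ j3)) =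
    (\<theta> ^ (2 ^ j1) - \<theta> ^ (2 ^ j2)) * (\<theta> ^ (2 ^ i2) - \<theta> ^ (2 ^ i3))"

lemma similar_triples_expand:
  assumes "similar_triples i1 i2 i3 j1 j2 j3"
  shows "\<theta> ^ (2 ^ j2 + 2 ^ i3) + \<theta> ^ (2 ^ j1 + 2 ^ i2) + \<theta> ^ (2 ^ i1 + 2 ^ j3) =
    \<theta> ^ (2 ^ j1 + 2 ^ i3) + \<theta> ^ (2 ^ i2 + 2 ^ j3) + \<theta> ^ (2 ^ i1 + 2 ^ j2)"
  using assms by (simp add: algebra_simps power_add)

text \<open>If \<open>j3 < i3\<close>, then \<open>2 ^ j2 + 2 ^ i3\<close> dominates: apart from
  \<open>2 ^ j1 + 2 ^ i3\<close>, every other exponent is built from two indices below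
  \<open>i3\<close>.\<close>

lemma similar_triples_last_le:
  assumes "i1 < i2" "i2 < i3" "i3 < n" "j1 < j2" "j2 < j3" "j3 < n"
    and eq: "similar_triples i1 i2 i3 j1 j2 j3"
  shows "i3 \<le> j3"
proof (rule ccontr)
  assume "\<not> i3 \<le> j3"
  then have lt: "j3 < i3" by simp
  have le: "(2 :: nat) ^ a + 2 ^ b < 2 ^ j2 + 2 ^ i3" if "a < i3" "b < i3" for a b
    using two_powers_le[OF that] by (simp add: add_strict_increasing)
  have "2 ^ j2 + 2 ^ i3 < e" using assms lt by (intro exponent_bound) auto
  moreover have "(2 :: nat) ^ j1 + 2 ^ i3 < 2 ^ j2 + 2 ^ i3" using assms by simp
  ultimately show False
    using no_dominant_power[of "2 ^ j2 + 2 ^ i3" "2 ^ j1 + 2 ^ i2" "2 ^ i1 + 2 ^ j3"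
        "2 ^ j1 + 2 ^ i3" "2 ^ i2 + 2 ^ j3" "2 ^ i1 + 2 ^ j2"]
      similar_triples_expand[OF eq] le assms lt by (meson less_trans)
qed

text \<open>With a common last index \<open>m\<close> and \<open>j2 < i2\<close>, the dominant
  exponent is \<open>2 ^ i2 + 2 ^ m\<close>; the others with \<open>2 ^ m\<close> have a partner
  index below \<open>i2\<close>.\<close>

lemma similar_triples_middle_le:
  assumes "i1 < i2" "i2 < m" "m < n" "j1 < j2" "j2 < m"
    and eq: "similar_triples i1 i2 m j1 j2 m"
  shows "i2 \<le> j2"
proof (rule ccontr)
  assume "\<not> i2 \<le> j2"
  then have lt: "j2 < i2" by simp
  have le: "(2 :: nat) ^ a + 2 ^ b < 2 ^ i2 + 2 ^ m" if "a < m" "b < m" for a b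
    using two_powers_le[OF that] by (simp add: add_strict_increasing)
  have lt': "(2 :: nat) ^ a + 2 ^ m < 2 ^ i2 + 2 ^ m" if "a < i2" for a
    using that by simp
  have "2 ^ i2 + 2 ^ m < e" using assms by (intro exponent_bound) auto
  moreover have "\<theta> ^ (2 ^ i2 + 2 ^ m) + \<theta> ^ (2 ^ j1 + 2 ^ m) + \<theta> ^ (2 ^ i1 + 2 ^ j2) =
      \<theta> ^ (2 ^ j2 + 2 ^ m) + \<theta> ^ (2 ^ j1 + 2 ^ i2) + \<theta> ^ (2 ^ i1 + 2 ^ m)"
    using similar_triples_expand[OF eq] by (simp add: algebra_simps)
  ultimately show False
    using no_dominant_power[of "2 ^ i2 + 2 ^ m" "2 ^ j1 + 2 ^ m" "2 ^ i1 + 2 ^ j2"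
        "2 ^ j2 + 2 ^ m" "2 ^ j1 + 2 ^ i2" "2 ^ i1 + 2 ^ m"]
      le lt' assms lt by (meson less_trans)
qed

text \<open>If \<open>j1 < i1\<close>, the dominant exponent is \<open>2 ^ i1 + 2 ^ m\<close>, once
  the power with exponent \<open>2 ^ l + 2 ^ m\<close> has cancelled.\<close>

lemma similar_triples_first_le:
  assumes "i1 < l" "j1 < l" "l < m" "m < n"
    and eq: "similar_triples i1 l m j1 l m"
  shows "i1 \<le> j1"
proof (rule ccontr)
  assume "\<not> i1 \<le> j1"
  then have lt: "j1 < i1" by simp
  have le: "(2 :: nat) ^ a + 2 ^ b < 2 ^ i1 + 2 ^ m" if "a < m" "b < m" for a b
    using two_powers_le[OF that] by (simp add: add_strict_increasing)
  have "2 ^ i1 + 2 ^ m < e" using assms by (intro exponent_bound) auto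
  moreover have "(2 :: nat) ^ j1 + 2 ^ m < 2 ^ i1 + 2 ^ m" "(0 :: nat) < 2 ^ i1 + 2 ^ m"
    using lt by simp_all
  \<comment> \<open>After the cancellation two terms remain on each side;
    \<open>\<theta> ^ 0\<close> pads them to three.\<close>
  moreover have "\<theta> ^ (2 ^ i1 + 2 ^ m) + \<theta> ^ (2 ^ j1 + 2 ^ l) + \<theta> ^ 0 =
      \<theta> ^ (2 ^ j1 + 2 ^ m) + \<theta> ^ (2 ^ i1 + 2 ^ l) + \<theta> ^ 0"
    using similar_triples_expand[OF eq] by (simp add: algebra_simps)
  ultimately show False
    using no_dominant_power[of "2 ^ i1 + 2 ^ m" "2 ^ j1 + 2 ^ l" 0
        "2 ^ j1 + 2 ^ m" "2 ^ i1 + 2 ^ l" 0]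
      le assms lt by (meson less_trans)
qed

text \<open>The relation is symmetric in the two triples, so each inequality holds both ways. The
  order last, middle, first is forced, as each comparison takes the later indices as equal.\<close>

lemma similar_triples_unique:
  assumes "i1 < i2" "i2 < i3" "i3 < n" "j1 < j2" "j2 < j3" "j3 < n"
    and eq: "similar_triples i1 i2 i3 j1 j2 j3"
  shows "i1 = j1 \<and> i2 = j2 \<and> i3 = j3"
proof -
  have eq': "similar_triples j1 j2 j3 i1 i2 i3" by (rule eq[symmetric])
  have 3: "i3 = j3"
    using similar_triples_last_le[OF assms] similar_triples_last_le[OF assms(4-6,1-3) eq'] by simp
  have 2: "i2 = j2"
    using similar_triples_middle_le[of i1 i2 j3 j1 j2] similar_triples_middle_le[of j1 j2 j3 i1 i2]
      assms eq' 3 by simp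
  have "i1 = j1"
    using similar_triples_first_le[of i1 j2 j1 j3] similar_triples_first_le[of j1 j2 i1 j3]
      assms eq' 2 3 by simp
  then show ?thesis using 2 3 by simp
qed

end

section \<open>From similar triples to the minimum distance of the code\<close>

text \<open>Subtracting the equations pairwise eliminates \<open>a\<close> and \<open>a'\<close>;
  eliminating \<open>b\<close> and \<open>b'\<close> then leaves similar triples of locators, which
  must coincide.\<close>

lemma affine_words_common_triple:
  fixes \<theta> :: "'a :: field"
  assumes indep: "\<And>d. d < e \<Longrightarrow> \<theta> ^ d \<notin> int_span \<theta> d"
    and small: "3 * 2 ^ (n - 2) < e"
    and i: "i1 < i2" "i2 < i3" "i3 < n" and j: "j1 < j2" "j2 < j3" "j3 < n"
    and e1: "a + b * \<theta> ^ (2 ^ i1) = a' + b' * \<theta> ^ (2 ^ j1)"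
    and e2: "a + b * \<theta> ^ (2 ^ i2) = a' + b' * \<theta> ^ (2 ^ j2)"
    and e3: "a + b * \<theta> ^ (2 ^ i3) = a' + b' * \<theta> ^ (2 ^ j3)"
  shows "a = a' \<and> b = b'"
proof -
  have inj: "inj_on (\<lambda>j. \<theta> ^ (2 ^ j)) {..<n}" by (rule inj_on_iterated_squares[OF indep small])
  define x1 x2 x3 where x: "x1 = \<theta> ^ (2 ^ i1)" "x2 = \<theta> ^ (2 ^ i2)" "x3 = \<theta> ^ (2 ^ i3)"
  define y1 y2 y3 where y: "y1 = \<theta> ^ (2 ^ j1)" "y2 = \<theta> ^ (2 ^ j2)" "y3 = \<theta> ^ (2 ^ j3)"
  note E = e1[folded x y] e2[folded x y] e3[folded x y]
  have ne: "x1 \<noteq> x2" "y1 \<noteq> y2"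
    using inj_onD[OF inj, of i1 i2] inj_onD[OF inj, of j1 j2] i j unfolding x y by auto
  have d1: "b * (x1 - x2) = b' * (y1 - y2)" and d2: "b * (x2 - x3) = b' * (y2 - y3)"
  proof -
    have "b * (x1 - x2) = (a + b * x1) - (a + b * x2)" by (simp add: algebra_simps)
    then show "b * (x1 - x2) = b' * (y1 - y2)" unfolding E by (simp add: algebra_simps)
    have "b * (x2 - x3) = (a + b * x2) - (a + b * x3)" by (simp add: algebra_simps)
    then show "b * (x2 - x3) = b' * (y2 - y3)" unfolding E by (simp add: algebra_simps)
  qed
  show ?thesis
  proof (cases "b = 0 \<or> b' = 0")
    case True
    \<comment> \<open>Since the locators are distinct, one vanishing slope forces the other to
      vanish, and both words are constant.\<close>
    then have "b = 0" "b' = 0" using d1 ne by auto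
    then show ?thesis using E by simp
  next
    case False
    have "b * b' * ((x1 - x2) * (y2 - y3)) = (b * (x1 - x2)) * (b' * (y2 - y3))" by simp
    also have "\<dots> = b * b' * ((y1 - y2) * (x2 - x3))" unfolding d1 d2[symmetric] by simp
    finally have "(x1 - x2) * (y2 - y3) = (y1 - y2) * (x2 - x3)" using False by simp
    then have "i1 = j1 \<and> i2 = j2 \<and> i3 = j3"
      unfolding x y using similar_triples_unique[OF indep small i j] by blast
    \<comment> \<open>The two affine functions now agree at two distinct points.\<close>
    then have "x1 = y1" "x2 = y2" unfolding x y by auto
    then have "b = b'" using d1 ne by simp
    then show ?thesis using E \<open>x1 = y1\<close> by simp
  qed
qed

theorem corollaryC:
  fixes p e n :: nat
    and \<theta> :: "'a :: finite_field"
    and C :: "'a vec set"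
  assumes "prime p"
    and "e > 1"
    and "card (UNIV :: 'a set) = p ^ e"
    and "n \<ge> 3"
    and "3 * 2 ^ (n - 2) < e"
    and "primitive_element \<theta>"
  defines "C \<equiv> {vec n (\<lambda>j. a + b * \<theta> ^ (2 ^ j)) | a b. True}"
  shows "reed_solomon_code n 2 C \<and> linear_code n 2 C \<and> min_insdel_dist C = 2 * n - 4"
proof -
  \<comment> \<open>Positions are counted from 0, so \<open>2 ^ j\<close> is the exponent of the
    locator number \<open>j + 1\<close>.\<close>
  let ?x = "\<lambda>j. \<theta> ^ (2 ^ j)"
  let ?w = "\<lambda>a b. vec n (\<lambda>j. a + b * ?x j)"
  have "prime CHAR('a)" by (rule prime_CHAR_semidom) simp
  moreover have "CHAR('a) dvd p ^ e" using CHAR_dvd_CARD[where ?'a = 'a] assms(3) by simp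
  ultimately have "CHAR('a) = p"
    using assms(1) by (meson prime_dvd_power primes_dvd_imp_eq)
  then have indep: "\<theta> ^ d \<notin> int_span \<theta> d" if "d < e" for d
    using primitive_power_notin_int_span assms(3,6) that by metis
  have inj: "inj_on ?x {..<n}" by (rule inj_on_iterated_squares[OF indep assms(5)])

  have rs: "reed_solomon_code n 2 C"
  proof -
    have "C = {vec n (\<lambda>j. poly f (?x j)) | f. degree f < 2}"
    proof (intro equalityI subsetI)
      fix c assume "c \<in> C"
      then obtain a b where "c = ?w a b" unfolding C_def by blast
      then have "c = vec n (\<lambda>j. poly [:a, b:] (?x j))" by (simp add: mult.commute)
      moreover have "degree [:a, b:] < 2" by simp
      ultimately show "c \<in> {vec n (\<lambda>j. poly f (?x j)) | f. degree f < 2}" by blast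
    next
      fix c assume "c \<in> {vec n (\<lambda>j. poly f (?x j)) | f. degree f < 2}"
      then obtain f where f: "c = vec n (\<lambda>j. poly f (?x j))" "degree f < 2" by blast
      have "f = [:Polynomial.coeff f 0, Polynomial.coeff f 1:]"
        using f(2) by (intro poly_eqI) (auto simp: coeff_pCons coeff_eq_0 split: nat.splits)
      then have "c = ?w (Polynomial.coeff f 0) (Polynomial.coeff f 1)"
        unfolding f(1) by (metis (no_types, lifting) mult.commute add.right_neutral poly_pCons poly_0 mult_zero_right)
      then show "c \<in> C" unfolding C_def by blast
    qed
    then show ?thesis unfolding reed_solomon_code_def using inj assms(4) by auto
  qed

  have lower: "2 * n - 4 \<le> insdel_dist (list_of_vec c) (list_of_vec d)"
    if cd: "c \<in> C" "d \<in> C" "c \<noteq> d" for c d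
  proof -
    obtain a b a' b' where c: "c = ?w a b" and d: "d = ?w a' b'"
      using cd(1,2) unfolding C_def by blast
    obtain zs where zs: "subseq zs (list_of_vec c)" "subseq zs (list_of_vec d)"
      "2 * n \<le> insdel_dist (list_of_vec c) (list_of_vec d) + 2 * length zs"
      using common_subseq_of_insdel_dist[of "list_of_vec c" "list_of_vec d"] c d by auto
    have "length zs \<le> 2"
    \<comment> \<open>The first three symbols of a longer \<open>zs\<close> would sit at increasing
      positions in both words and force the words to be equal.\<close>
    proof (rule ccontr)
      assume "\<not> length zs \<le> 2"
      then have l: "0 < length zs" "1 < length zs" "2 < length zs" by auto
      obtain f where f: "strict_mono_on {..<length zs} f"
        "\<And>i. i < length zs \<Longrightarrow> f i < n \<and> a + b * ?x (f i) = zs ! i"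
        using subseq_embedding[OF zs(1)] unfolding c
        by (metis (no_types, lifting) dim_vec index_vec length_list_of_vec list_of_vec_index)
      obtain g where g: "strict_mono_on {..<length zs} g"
        "\<And>i. i < length zs \<Longrightarrow> g i < n \<and> a' + b' * ?x (g i) = zs ! i"
        using subseq_embedding[OF zs(2)] unfolding d
        by (metis (no_types, lifting) dim_vec index_vec length_list_of_vec list_of_vec_index)
      have "a = a' \<and> b = b'"
        by (rule affine_words_common_triple[OF indep assms(5),
              of "f 0" "f 1" "f 2" "g 0" "g 1" "g 2"])
          (use l f g in \<open>auto simp: strict_mono_on_def\<close>)
      then show False using cd(3) c d by simp
    qed
    then show ?thesis using zs(3) by simp
  qed

  have "\<exists>c\<in>C. \<exists>d\<in>C. c \<noteq> d \<and> insdel_dist (list_of_vec c) (list_of_vec d) \<le> 2 * n - 4"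
  proof -
    text \<open>The line through \<open>(x 1, x 0)\<close> and \<open>(x 2, x 1)\<close> makes the first two symbols of
      one word reappear shifted by one position in the other.\<close>
    define b where "b = (?x 1 - ?x 0) / (?x 2 - ?x 1)"
    define a where "a = ?x 0 - b * ?x 1"
    have ne: "?x 2 \<noteq> ?x 1" "?x 1 \<noteq> ?x 0"
      using inj_onD[OF inj, of 2 1] inj_onD[OF inj, of 1 0] assms(4) by auto
    have s1: "a + b * ?x 1 = ?x 0" by (simp add: a_def)
    have "b * (?x 2 - ?x 1) = ?x 1 - ?x 0" using ne by (simp add: b_def)
    then have s2: "a + b * ?x 2 = ?x 1" by (simp add: a_def algebra_simps)
    \<comment> \<open>\<open>?z\<close> fills positions 0 and 1 of \<open>?c\<close> and positions 1
      and 2 of \<open>?d\<close>, so \<open>n - 2\<close> deletions and \<open>n - 2\<close>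
      insertions suffice.\<close>
    let ?c = "?w 0 1" and ?d = "?w a b" and ?z = "[?x 0, ?x 1]"
    have "?c $ 1 \<noteq> ?d $ 1" using ne s1 assms(4) by simp
    then have "?c \<noteq> ?d" by metis
    obtain m where n: "n = Suc (Suc (Suc m))"
      using assms(4) by (metis Suc_le_D numeral_3_eq_3 Suc_le_mono)
    have upt: "[0..<n] = 0 # 1 # 2 # [3..<n]" unfolding n by (simp add: upt_rec numeral_eq_Suc)
    have lv: "list_of_vec (vec n h) = map h [0..<n]" for h :: "nat \<Rightarrow> 'a"
      by (rule nth_equalityI) (auto simp: list_of_vec_index)
    have "subseq ?z (list_of_vec ?c)" unfolding lv upt by simp
    moreover have "subseq ?z (list_of_vec ?d)"
      unfolding lv upt list.map s1 s2 by (rule list_emb_Cons) simp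
    ultimately have "insdel_dist (list_of_vec ?c) (list_of_vec ?d) \<le> 2 * n - 4"
      using insdel_dist_le[of ?z "list_of_vec ?c" "list_of_vec ?d"] by simp
    moreover have "?c \<in> C" "?d \<in> C" unfolding C_def by blast+
    ultimately show ?thesis using \<open>?c \<noteq> ?d\<close> by blast
  qed
  \<comment> \<open>For the pair just found, the upper bound meets \<open>lower\<close>, so the
    infimum is attained there.\<close>
  then have "min_insdel_dist C = 2 * n - 4"
    unfolding min_insdel_dist_def using lower
    by (intro cInf_eq_minimum) (blast intro: antisym | force)+
  then show ?thesis using rs reed_solomon_code_linear[OF rs] by simp
qed

end
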